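(* Every virtual knot is $v\Delta$-equivalent to the trivial knot; that is, the virtualized $\Delta$-move is an unknotting operation for virtual knots.
   Context: A virtual link diagram is a generic immersion of finitely many oriented circles in the plane in which each double point is either a real crossing (with over/under information) or a virtual crossing. Virtual links are equivalence classes of such diagrams under generalized Reidemeister moves (the classical Reidemeister moves I, II, III together with the virtual moves involving virtual crossings); equivalently, they are equivalence classes of Gauss diagrams under the Reidemeister moves I, II, III on Gauss diagrams. In a Gauss diagram, each real crossing is recorded as a signed chord oriented from the over-crossing point (initial endpoint) to the under-crossing point (terminal endpoint). A virtual knot is a one-component virtual link. A virtualized $\Delta$-move ($v\Delta$) is the following local deformation of a virtual link diagram, performed in either direction. In a disk, three strands (with arbitrary orientations, belonging to arbitrary components) pairwise cross exactly once, forming a triangle, and all three crossings are real and alternating, i.e. each strand passes over one of the other two strands and under the other one; the move replaces the three real crossings by three virtual crossings. Both alternating patterns (mirror images of each other) are allowed. In terms of Gauss diagrams, the move deletes or inserts three chords of the following form: there are three disjoint arcs $s_1,s_2,s_3$ of the underlying circles, the three chords run from $s_1$ to $s_2$, from $s_2$ to $s_3$ and from $s_3$ to $s_1$, and the $s_i$ contain no other chord endpoints; setting $\eta_i=+1$ if along the oriented arc $s_i$ the terminal endpoint precedes the initial endpoint and $\eta_i=-1$ otherwise, the sign of the chord joining $s_i$ and $s_j$ is $\delta\eta_i\eta_j$ with a common $\delta\in\{+1,-1\}$ for all three chords (the two values of $\delta$ correspond to the two alternating patterns). Two virtual links are $v\Delta$-equivalent if their diagrams are related by a finite sequence of virtualized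 $\Delta$-moves and generalized Reidemeister moves. *)

theory Defs
  imports Main
begin

section \<open>Gauss diagrams\<close>

text \<open>
  The endpoints met while traversing an oriented circle from a base point form a word.
  \<open>Over c e\<close> is the initial endpoint (over-crossing point) and \<open>Under c e\<close> the terminal endpoint
  (under-crossing point) of the chord with name \<open>c\<close> and sign \<open>e\<close>. A Gauss diagram is a list of
  words, one for each circle; a circle without endpoints is the empty word.
  Base points, chord names and the order of the circles carry no information, see
  \<open>gauss_iso\<close> below.
\<close>

datatype endpoint = is_Over: Over (chord: nat) (sign: int) | is_Under: Under (chord: nat) (sign: int)

definition gauss_diagram :: "endpoint list list \<Rightarrow> bool" where
  "gauss_diagram D \<longleftrightarrow>
     (let w = concat D in
       distinct w \<and>
       (\<forall>x \<in> set w. sign x = 1 \<or> sign x = -1) \<and>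
       (\<forall>x \<in> set w. \<forall>y \<in> set w. chord x = chord y \<longrightarrow> sign x = sign y) \<and>
       (\<forall>c e. Over c e \<in> set w \<longleftrightarrow> Under c e \<in> set w))"

primrec rename :: "(nat \<Rightarrow> nat) \<Rightarrow> endpoint \<Rightarrow> endpoint" where
  "rename f (Over c e) = Over (f c) e"
| "rename f (Under c e) = Under (f c) e"

inductive gauss_iso :: "endpoint list list \<Rightarrow> endpoint list list \<Rightarrow> bool" where
  base_point: "gauss_iso (A @ (u @ v) # B) (A @ (v @ u) # B)"
| reorder: "gauss_iso (A @ u # v # B) (A @ v # u # B)"
| rename: "inj_on f (chord ` set (concat D)) \<Longrightarrow> gauss_iso D (map (map (rename f)) D)"


section \<open>Local moves\<close>

text \<open>
  A local move changes a Gauss diagram on \<open>k\<close> disjoint arcs of its circles only. The unchanged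
  part is a diagram with \<open>k\<close> marked places \<open>Arc 0, \<dots>, Arc (k - 1)\<close>, which may lie on the same or
  on different circles and in any order. The words read along the arcs before and after the move
  are \<open>ss\<close> and \<open>ss'\<close>. That an arc does not contain a base point can always be achieved
  by \<open>gauss_iso\<close>.
\<close>

datatype token = End endpoint | Arc nat

primrec fill_token :: "endpoint list list \<Rightarrow> token \<Rightarrow> endpoint list" where
  "fill_token ss (End x) = [x]"
| "fill_token ss (Arc i) = ss ! i"

definition fill :: "endpoint list list \<Rightarrow> token list list \<Rightarrow> endpoint list list" where
  "fill ss C = map (\<lambda>w. concat (map (fill_token ss) w)) C"

definition local_move ::
  "endpoint list list \<Rightarrow> endpoint list list \<Rightarrow> endpoint list list \<Rightarrow> endpoint list list \<Rightarrow> bool" where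
  "local_move ss ss' D D' \<longleftrightarrow>
     length ss = length ss' \<and>
     (\<exists>C. (\<forall>i. count_list (concat C) (Arc i) = (if i < length ss then 1 else 0)) \<and>
          D = fill ss C \<and> D' = fill ss' C)"

definition arc :: "int \<Rightarrow> endpoint \<Rightarrow> endpoint \<Rightarrow> endpoint list" where
  "arc h x y = (if h = 1 then [x, y] else [y, x])"

text \<open>
  The rules do not require chord names to be distinct or signs to be \<open>1\<close> or \<open>-1\<close>: the steps defined
  below only relate diagrams satisfying \<open>gauss_diagram\<close>, which excludes all other instances.

  Moves II: one strand passes over the other in both crossings, which have opposite signs; the
  two strands run in parallel (\<open>R2_parallel\<close>) or in opposite directions (\<open>R2_opposite\<close>).

  Move III: \<open>a\<close> is the crossing of the top strand over the middle strand, \<open>b\<close> of the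
  top strand over the bottom strand and \<open>c\<close> of the middle strand over the bottom strand. The
  arcs are the top, the middle and the bottom strand. In the cyclic order top, middle, bottom,
  \<open>p\<close>, \<open>q\<close>, \<open>r\<close> tell whether a strand meets its predecessor before its
  successor (value \<open>1\<close>) or after it (value \<open>-1\<close>), that is, up to a common sign, whether
  its orientation agrees with that of the boundary of the triangle. For strands \<open>i\<close>, \<open>j\<close> the
  determinant of the pair of directions of \<open>i\<close> and its successor \<open>j\<close> has sign
  \<open>\<delta>\<close> times the product of their values. This is the sign of the crossing if
  \<open>i\<close> passes over \<open>j\<close>, and minus that sign if \<open>j\<close> passes over \<open>i\<close>, which occurs only for
  the crossing \<open>b\<close>. The move reverses the order of the two crossings on each strand.
\<close>

inductive reidemeister_move :: "endpoint list list \<Rightarrow> endpoint list list \<Rightarrow> bool" where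
  R1_over_under:
    "local_move [[Over c e, Under c e]] [[]] D D' \<Longrightarrow> reidemeister_move D D'"
| R1_under_over:
    "local_move [[Under c e, Over c e]] [[]] D D' \<Longrightarrow> reidemeister_move D D'"
| R2_parallel:
    "local_move [[Over c e, Over d (-e)], [Under c e, Under d (-e)]] [[], []] D D' \<Longrightarrow>
     reidemeister_move D D'"
| R2_opposite:
    "local_move [[Over c e, Over d (-e)], [Under d (-e), Under c e]] [[], []] D D' \<Longrightarrow>
     reidemeister_move D D'"
| R3:
    "{\<delta>, p, q, r} \<subseteq> {1, -1} \<Longrightarrow>
     ea = \<delta> * p * q \<Longrightarrow> eb = - \<delta> * r * p \<Longrightarrow> ec = \<delta> * q * r \<Longrightarrow>
     local_move
       [arc p (Over b eb) (Over a ea), arc q (Under a ea) (Over c ec), arc r (Under c ec) (Under b eb)]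
       [arc (-p) (Over b eb) (Over a ea), arc (-q) (Under a ea) (Over c ec),
        arc (-r) (Under c ec) (Under b eb)] D D' \<Longrightarrow>
     reidemeister_move D D'"

text \<open>
  The chords \<open>a\<close>, \<open>b\<close>, \<open>c\<close> run from the first to the second, from the second to the third and
  from the third to the first arc; \<open>p\<close>, \<open>q\<close>, \<open>r\<close> are \<open>1\<close> if the terminal endpoint precedes
  the initial endpoint on the respective arc and \<open>-1\<close> otherwise.
\<close>

inductive vdelta_move :: "endpoint list list \<Rightarrow> endpoint list list \<Rightarrow> bool" where
  "{\<delta>, p, q, r} \<subseteq> {1, -1} \<Longrightarrow>
   ea = \<delta> * p * q \<Longrightarrow> eb = \<delta> * q * r \<Longrightarrow> ec = \<delta> * r * p \<Longrightarrow>
   local_move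
     [arc p (Under c ec) (Over a ea), arc q (Under a ea) (Over b eb), arc r (Under b eb) (Over c ec)]
     [[], [], []] D D' \<Longrightarrow>
   vdelta_move D D'"


section \<open>Virtual links\<close>

definition reidemeister_step :: "endpoint list list \<Rightarrow> endpoint list list \<Rightarrow> bool" where
  "reidemeister_step D D' \<longleftrightarrow>
     gauss_diagram D \<and> gauss_diagram D' \<and> (gauss_iso D D' \<or> reidemeister_move D D')"

definition vdelta_step :: "endpoint list list \<Rightarrow> endpoint list list \<Rightarrow> bool" where
  "vdelta_step D D' \<longleftrightarrow> gauss_diagram D \<and> gauss_diagram D' \<and> vdelta_move D D'"

definition reidemeister_rel :: "(endpoint list list \<times> endpoint list list) set" where
  "reidemeister_rel =
     {(D, D'). gauss_diagram D \<and> gauss_diagram D' \<and> equivclp reidemeister_step D D'}"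

definition virtual_links :: "endpoint list list set set" where
  "virtual_links = {D. gauss_diagram D} // reidemeister_rel"

definition virtual_knots :: "endpoint list list set set" where
  "virtual_knots = {K \<in> virtual_links. \<exists>D \<in> K. length D = 1}"

definition trivial_knot :: "endpoint list list set" where
  "trivial_knot = reidemeister_rel `` {[[]]}"

definition vdelta_equivalent :: "endpoint list list set \<Rightarrow> endpoint list list set \<Rightarrow> bool" where
  "vdelta_equivalent K L \<longleftrightarrow>
     (\<exists>D \<in> K. \<exists>D' \<in> L. equivclp (sup reidemeister_step vdelta_step) D D')"


section \<open>Independence of the choice of diagrams\<close>

lemma equiv_reidemeister_rel: "equiv {D. gauss_diagram D} reidemeister_rel"
proof (rule equivI)
  show "reidemeister_rel \<subseteq> {D. gauss_diagram D} \<times> {D. gauss_diagram D}"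
    by (auto simp: reidemeister_rel_def)
  show "refl_on {D. gauss_diagram D} reidemeister_rel"
    by (rule refl_onI) (simp add: reidemeister_rel_def)
  show "sym reidemeister_rel"
    by (rule symI) (simp add: reidemeister_rel_def equivclp_sym)
  show "trans reidemeister_rel"
  proof (rule transI)
    fix D D' D''
    assume "(D, D') \<in> reidemeister_rel" and "(D', D'') \<in> reidemeister_rel"
    then show "(D, D'') \<in> reidemeister_rel"
      using equivclp_trans[of reidemeister_step D D' D''] by (simp add: reidemeister_rel_def)
  qed
qed

lemma trivial_knot_in_virtual_knots: "trivial_knot \<in> virtual_knots"
proof -
  have g: "gauss_diagram [[]]" by (simp add: gauss_diagram_def)
  then have "[[]] \<in> trivial_knot"
    by (simp add: trivial_knot_def reidemeister_rel_def)
  moreover have "trivial_knot \<in> virtual_links"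
    unfolding trivial_knot_def virtual_links_def using g by (intro quotientI) simp
  ultimately show ?thesis unfolding virtual_knots_def by force
qed

lemma length_gauss_iso: "gauss_iso D D' \<Longrightarrow> length D = length D'"
  by (induction rule: gauss_iso.induct) auto

lemma length_local_move: "local_move ss ss' D D' \<Longrightarrow> length D = length D'"
  by (auto simp: local_move_def fill_def)

lemma length_reidemeister_move: "reidemeister_move D D' \<Longrightarrow> length D = length D'"
  by (erule reidemeister_move.cases; drule length_local_move; simp)

lemma length_reidemeister_equivclp:
  assumes "equivclp reidemeister_step D D'"
  shows "length D = length D'"
  using assms
proof (induction rule: equivclp_induct)
  case base
  show ?case by simp
next
  case (step y z)
  then have "length y = length z"
    unfolding reidemeister_step_def by (metis length_gauss_iso length_reidemeister_move)
  with step.IH show ?case by simp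
qed

lemma virtual_knots_iff_all:
  "K \<in> virtual_knots \<longleftrightarrow> K \<in> virtual_links \<and> (\<forall>D \<in> K. length D = 1)"
proof
  assume K: "K \<in> virtual_knots"
  then obtain D where D: "D \<in> K" "length D = 1" and L: "K \<in> virtual_links"
    by (auto simp: virtual_knots_def)
  have "length D' = 1" if "D' \<in> K" for D'
  proof -
    have "(D, D') \<in> reidemeister_rel"
      using quotient_eq_iff[OF equiv_reidemeister_rel, of K K D D'] L D(1) that
      by (simp add: virtual_links_def)
    then show ?thesis using length_reidemeister_equivclp D(2)
      by (auto simp: reidemeister_rel_def)
  qed
  with L show "K \<in> virtual_links \<and> (\<forall>D \<in> K. length D = 1)" by blast
next
  assume K: "K \<in> virtual_links \<and> (\<forall>D \<in> K. length D = 1)"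
  then have "K \<noteq> {}"
    using in_quotient_imp_non_empty[OF equiv_reidemeister_rel] by (auto simp: virtual_links_def)
  with K show "K \<in> virtual_knots" by (auto simp: virtual_knots_def)
qed

lemma vdelta_equivalent_iff_all:
  assumes K: "K \<in> virtual_links" and L: "L \<in> virtual_links"
  shows "vdelta_equivalent K L \<longleftrightarrow>
    (\<forall>D \<in> K. \<forall>D' \<in> L. equivclp (sup reidemeister_step vdelta_step) D D')"
proof -
  let ?R = "equivclp (sup reidemeister_step vdelta_step)"
  have mono: "?R D D'" if "equivclp reidemeister_step D D'" for D D'
    using that
  proof (induction rule: equivclp_induct)
    case base
    show ?case by simp
  next
    case (step y z)
    then have "sup reidemeister_step vdelta_step y z \<or> sup reidemeister_step vdelta_step z y" by auto
    with step.IH show ?case by (rule equivclp_into_equivclp)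
  qed
  have rel: "?R D D'" if "M \<in> virtual_links" "D \<in> M" "D' \<in> M" for M D D'
    using quotient_eq_iff[OF equiv_reidemeister_rel, of M M D D'] that mono
    by (auto simp: virtual_links_def reidemeister_rel_def)
  have ne: "M \<noteq> {}" if "M \<in> virtual_links" for M
    using in_quotient_imp_non_empty[OF equiv_reidemeister_rel] that by (auto simp: virtual_links_def)
  show ?thesis
  proof
    assume "vdelta_equivalent K L"
    then obtain D0 D0' where "D0 \<in> K" "D0' \<in> L" "?R D0 D0'"
      by (auto simp: vdelta_equivalent_def)
    then show "\<forall>D \<in> K. \<forall>D' \<in> L. ?R D D'"
      using rel[OF K] rel[OF L] by (meson equivclp_trans)
  next
    assume "\<forall>D \<in> K. \<forall>D' \<in> L. ?R D D'"
    then show "vdelta_equivalent K L"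
      using ne[OF K] ne[OF L] by (auto simp: vdelta_equivalent_def)
  qed
qed

end

theory Submission
  imports Defs "HOL-Library.Multiset"
begin

text \<open>
  The point is that modulo the virtualized \<open>\<Delta>\<close>-move a chord keeps only the information which two
  places of the diagram it joins. Let chords \<open>x\<close> from \<open>P\<close> to \<open>M\<close> and \<open>y\<close> from \<open>M\<close> to \<open>Q\<close> have
  adjacent endpoints at \<open>M\<close>. A move II creates parallel chords \<open>t\<close> and \<open>z\<close> of opposite signs
  from \<open>Q\<close> to \<open>P\<close>, placed so that \<open>t\<close> closes the triangle \<open>x\<close>, \<open>y\<close>, \<open>t\<close>; the \<open>\<Delta>\<close>-move deletes
  this triangle and leaves \<open>z\<close>. The condition on the signs can always be met: the global sign and
  the sides of \<open>P\<close> and \<open>Q\<close> at which \<open>t\<close> is attached are free, so \<open>z\<close> may have either sign and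
  the two endpoints at \<open>M\<close> may come in either order (\<open>merge_chords\<close>).

  This relation has two consequences. Reading it from \<open>z\<close> to \<open>x\<close>, \<open>y\<close> with \<open>M\<close> next to \<open>P\<close>, the
  chord \<open>x\<close> is isolated and disappears by a move I, so a chord from \<open>Q\<close> to \<open>P\<close> may be reversed
  (\<open>reverse_chord\<close>). Reading it forwards and backwards with the two orders at \<open>M\<close>, an adjacent
  over- and under-endpoint may be exchanged, and after reversing chords any two adjacent endpoints
  of different chords may be exchanged (\<open>swap_adjacent\<close>). On a single circle every chord can
  therefore be isolated and removed by a move I.
\<close>

section \<open>Diagrams with marked arcs\<close>

text \<open>
  The unchanged part of a local move, with its marked places and its endpoints \<open>E\<close>. Keeping \<open>E\<close>
  explicit reduces all questions whether a diagram is a Gauss diagram to statements about multisets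
  of endpoints.
\<close>

definition has_arcs :: "nat \<Rightarrow> endpoint list \<Rightarrow> token list list \<Rightarrow> bool" where
  "has_arcs k E C \<longleftrightarrow> mset (concat C) = mset (map End E @ map Arc [0..<k])"

primrec nest_token :: "token list list \<Rightarrow> token \<Rightarrow> token list" where
  "nest_token T (End x) = [End x]"
| "nest_token T (Arc i) = T ! i"

text \<open>
  Filling marked places with words that contain marked places themselves. This composition lets a
  move take place inside an arc that belongs to a larger pattern.
\<close>

definition nest :: "token list list \<Rightarrow> token list list \<Rightarrow> token list list" where
  "nest T C = map (\<lambda>w. concat (map (nest_token T) w)) C"

text \<open>
  The order in which the endpoints and the marked places occur is irrelevant for counting, so the
  words of a diagram with marked arcs may be replaced by the normal form of \<open>has_arcs\<close>.
\<close>

lemma mset_concat_map_cong: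
  assumes "mset v = mset w"
  shows "mset (concat (map f v)) = mset (concat (map f w))"
proof -
  have "mset (concat (map f u)) = (\<Sum>x\<in>#mset u. mset (f x))" for u
    by (induction u) auto
  then show ?thesis using assms by simp
qed

lemma concat_map_concat_map: "concat (map (\<lambda>w. concat (map f w)) C) = concat (map f (concat C))"
  by (induction C) auto

lemma concat_map_singleton: "concat (map (\<lambda>x. [f x]) xs) = map f xs"
  by (induction xs) auto

lemma mset_concat_fill:
  assumes "has_arcs (length ss) E C"
  shows "mset (concat (fill ss C)) = mset (concat ss @ E)"
proof -
  have "mset (concat (fill ss C)) =
      mset (concat (map (fill_token ss) (map End E @ map Arc [0..<length ss])))"
    unfolding fill_def concat_map_concat_map
    by (rule mset_concat_map_cong) (use assms in \<open>simp add: has_arcs_def\<close>)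
  also have "\<dots> = mset (concat ss @ E)"
    by (simp add: comp_def concat_map_singleton map_nth)
  finally show ?thesis .
qed

lemma has_arcs_nest:
  assumes "has_arcs (length T) E C" and "has_arcs m E' T"
  shows "has_arcs m (E' @ E) (nest T C)"
proof -
  have "mset (concat (nest T C)) =
      mset (concat (map (nest_token T) (map End E @ map Arc [0..<length T])))"
    unfolding nest_def concat_map_concat_map
    by (rule mset_concat_map_cong) (use assms in \<open>simp add: has_arcs_def\<close>)
  also have "\<dots> = mset (map End E) + mset (concat T)"
    by (simp add: comp_def concat_map_singleton map_nth)
  finally show ?thesis using assms(2) by (simp add: has_arcs_def)
qed

lemma fill_nest:
  assumes "has_arcs (length T) E C"
  shows "fill ss (nest T C) = fill (fill ss T) C"
proof -
  have "concat (map (fill_token ss) (nest_token T x)) = fill_token (fill ss T) x"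
    if "x \<in> set (concat C)" for x
  proof (cases x)
    case (Arc i)
    have "set (concat C) = set (map End E @ map Arc [0..<length T])"
      using assms unfolding has_arcs_def by (rule mset_eq_setD)
    with that Arc have "i < length T" by auto
    with Arc show ?thesis by (simp add: fill_def)
  qed simp
  then have "concat (map (fill_token ss) (concat (map (nest_token T) w))) =
      concat (map (fill_token (fill ss T)) w)" if "w \<in> set C" for w
    using that
    by (subst concat_map_concat_map[symmetric], intro arg_cong[where f = concat] map_cong) auto
  then show ?thesis by (simp add: fill_def nest_def)
qed

lemma local_move_fill:
  assumes "has_arcs (length ss) E C" and "length ss = length ss'"
  shows "local_move ss ss' (fill ss C) (fill ss' C)"
proof -
  have "count_list (concat C) (Arc i) = (if i < length ss then 1 else 0)" for i
  proof -
    have "count_list (concat C) (Arc i) = count_list (map End E @ map Arc [0..<length ss]) (Arc i)"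
      using assms(1) unfolding has_arcs_def by (metis count_mset)
    also have "\<dots> = count_list [0..<length ss] i"
    proof -
      have "count_list (map End E) (Arc i) = 0" by (induction E) auto
      moreover have "count_list (map Arc ns) (Arc i) = count_list ns i" for ns
        by (induction ns) auto
      ultimately show ?thesis by simp
    qed
    also have "\<dots> = (if i < length ss then 1 else 0)"
      using count_mset[of "[0..<length ss]" i] distinct_count_atmost_1[of "[0..<length ss]"] by auto
    finally show ?thesis .
  qed
  then show ?thesis using assms(2) unfolding local_move_def by blast
qed

text \<open>
  Patterns \<open>A\<close> and \<open>A'\<close> that differ by a local move on smaller arcs still differ by this move once
  they are inserted into a diagram.
\<close>

lemma local_move_nest:
  assumes "has_arcs (length T) E C" and "has_arcs (length ss) E' T"
    and "length ss = length ss'" and "A = fill ss T" and "A' = fill ss' T"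
  shows "local_move ss ss' (fill A C) (fill A' C)"
  using local_move_fill[OF has_arcs_nest[OF assms(1,2)] assms(3)] fill_nest[OF assms(1)] assms(4,5)
  by simp


section \<open>Adding chords to Gauss diagrams\<close>

primrec chord_ends :: "(nat \<times> int) list \<Rightarrow> endpoint list" where
  "chord_ends [] = []"
| "chord_ends (p # cs) = Over (fst p) (snd p) # Under (fst p) (snd p) # chord_ends cs"

lemma gauss_diagram_cong:
  assumes "mset (concat D) = mset (concat D')"
  shows "gauss_diagram D = gauss_diagram D'"
  using mset_eq_setD[OF assms] mset_eq_imp_distinct_iff[OF assms]
  by (simp add: gauss_diagram_def Let_def)

lemma gauss_diagram_word:
  "gauss_diagram [w] \<longleftrightarrow> distinct w \<and> (\<forall>x \<in> set w. sign x = 1 \<or> sign x = -1) \<and>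
    (\<forall>x \<in> set w. \<forall>y \<in> set w. chord x = chord y \<longrightarrow> sign x = sign y) \<and>
    (\<forall>c e. Over c e \<in> set w \<longleftrightarrow> Under c e \<in> set w)"
  unfolding gauss_diagram_def Let_def concat.simps append_Nil2 ..

lemma gauss_diagram_add_chord:
  "gauss_diagram [Over c e # Under c e # w] \<longleftrightarrow>
    gauss_diagram [w] \<and> (e = 1 \<or> e = -1) \<and> c \<notin> chord ` set w"
  (is "?L \<longleftrightarrow> ?R")
proof
  assume L: ?L
  let ?w = "Over c e # Under c e # w"
  have dist: "distinct ?w" and sgn: "\<forall>x \<in> set ?w. sign x = 1 \<or> sign x = -1"
    and eq: "\<forall>x \<in> set ?w. \<forall>y \<in> set ?w. chord x = chord y \<longrightarrow> sign x = sign y"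
    and bal: "Over c' e' \<in> set ?w \<longleftrightarrow> Under c' e' \<in> set ?w" for c' e'
    using L unfolding gauss_diagram_word by blast+
  have new: "c \<notin> chord ` set w"
  proof
    assume "c \<in> chord ` set w"
    then obtain x where x: "x \<in> set w" "chord x = c" by blast
    have "sign (Over c e) = sign x"
      by (rule eq[rule_format]) (use x in simp_all)
    with x(2) have "x \<in> {Over c e, Under c e}" by (cases x) simp_all
    with x dist show False by auto
  qed
  then have absent: "Over c e' \<notin> set w" "Under c e' \<notin> set w" for e' by force+
  have "Over c' e' \<in> set w \<longleftrightarrow> Under c' e' \<in> set w" for c' e'
  proof (cases "c' = c")
    case False
    with bal[of c' e'] show ?thesis by simp
  qed (simp add: absent)
  moreover have "distinct w" "e = 1 \<or> e = -1" "\<forall>x \<in> set w. sign x = 1 \<or> sign x = -1"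
    using dist sgn by simp_all
  moreover have "\<forall>x \<in> set w. \<forall>y \<in> set w. chord x = chord y \<longrightarrow> sign x = sign y"
    using eq by (meson list.set_intros(2))
  ultimately show ?R using new unfolding gauss_diagram_word by blast
next
  assume R: ?R
  then have dist: "distinct w" and e: "e = 1 \<or> e = -1" and new: "c \<notin> chord ` set w"
    and sgn: "\<forall>x \<in> set w. sign x = 1 \<or> sign x = -1"
    and eq: "\<forall>x \<in> set w. \<forall>y \<in> set w. chord x = chord y \<longrightarrow> sign x = sign y"
    and bal: "\<forall>c e. Over c e \<in> set w \<longleftrightarrow> Under c e \<in> set w"
    unfolding gauss_diagram_word by blast+
  let ?w = "Over c e # Under c e # w"
  from new have absent: "Over c e \<notin> set w" "Under c e \<notin> set w" by force+
  have "distinct ?w" using dist absent by simp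
  moreover have "\<forall>x \<in> set ?w. sign x = 1 \<or> sign x = -1" using e sgn by simp
  moreover have "sign x = sign y"
    if "x \<in> set ?w" "y \<in> set ?w" "chord x = chord y" for x y
  proof (cases "chord x = c")
    case True
    with that(3) new have "x \<notin> set w" "y \<notin> set w" by (metis imageI)+
    with that show ?thesis by auto
  next
    case False
    with that have "x \<in> set w" "y \<in> set w" by auto
    with eq that(3) show ?thesis by blast
  qed
  moreover have "\<forall>c' e'. Over c' e' \<in> set ?w \<longleftrightarrow> Under c' e' \<in> set ?w" using bal by simp
  ultimately show ?L unfolding gauss_diagram_word by blast
qed

lemma gauss_diagram_fill:
  assumes "has_arcs (length ss) E C" and "mset (concat ss) = mset (chord_ends cs)"
  shows "gauss_diagram (fill ss C) \<longleftrightarrow> gauss_diagram [chord_ends cs @ E]"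
  using mset_concat_fill[OF assms(1)] assms(2) by (intro gauss_diagram_cong) simp


section \<open>Replacing two chords by one\<close>

abbreviation eqv :: "endpoint list list \<Rightarrow> endpoint list list \<Rightarrow> bool"  (infix "\<approx>" 50) where
  "D \<approx> D' \<equiv> equivclp (sup reidemeister_step vdelta_step) D D'"

lemma eqv_reidemeister:
  "reidemeister_move D D' \<Longrightarrow> gauss_diagram D \<Longrightarrow> gauss_diagram D' \<Longrightarrow> D \<approx> D'"
  by (rule r_into_equivclp) (simp add: reidemeister_step_def)

lemma eqv_vdelta:
  "vdelta_move D D' \<Longrightarrow> gauss_diagram D \<Longrightarrow> gauss_diagram D' \<Longrightarrow> D \<approx> D'"
  by (rule r_into_equivclp) (simp add: vdelta_step_def)

lemma exists_fresh: "\<exists>n. n \<notin> chord ` set w \<and> n \<notin> set ns"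
  using ex_new_if_finite[OF infinite_UNIV_nat, of "chord ` set w \<union> set ns"] by auto

text \<open>
  On the arc at \<open>M\<close> the sign \<open>q\<close> is given. For the triangle with the auxiliary chord \<open>t\<close> of sign
  \<open>- ez\<close> the equations \<open>ex = \<delta> p q\<close>, \<open>ey = \<delta> q r\<close>, \<open>et = \<delta> r p\<close> have the solution
  \<open>\<delta> = et ex ey\<close>, \<open>p = et ey q\<close>, \<open>r = et ex q\<close>. Hence no sign imposes any restriction; \<open>p\<close> and
  \<open>r\<close> only say on which side of \<open>Over x ex\<close> and \<open>Under y ey\<close> the endpoints of \<open>t\<close> are placed.
\<close>

lemma merge_chords:
  assumes C: "has_arcs 3 E C" and E: "gauss_diagram [E]"
    and fresh: "distinct [x, y, z]" "{x, y, z} \<inter> chord ` set E = {}"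
    and signs: "{ex, ey, ez, q} \<subseteq> {1, -1}"
  shows "fill [[Over x ex], arc q (Under x ex) (Over y ey), [Under y ey]] C \<approx>
    fill [[Under z ez], [], [Over z ez]] C"
proof -
  obtain t where t: "t \<notin> chord ` set E" "t \<notin> set [x, y, z]"
    using exists_fresh by blast
  define et where "et = - ez"
  define p where "p = et * ey * q"
  define r where "r = et * ex * q"
  define M where "M = arc q (Under x ex) (Over y ey)"
  \<comment> \<open>The endpoints of \<open>t\<close> lie between those of \<open>x\<close>, \<open>y\<close> and those of \<open>z\<close>, so that \<open>t\<close> is next to
    \<open>z\<close> for the move II and next to \<open>x\<close> and \<open>y\<close> for the triangle.\<close>
  define P where "P = (if p = 1 then [Under z ez, Under t et, Over x ex]
    else [Over x ex, Under t et, Under z ez])"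
  define Q where "Q = (if r = 1 then [Under y ey, Over t et, Over z ez]
    else [Over z ez, Over t et, Under y ey])"
  have M: "mset M = {#Under x ex, Over y ey#}"
    by (auto simp: M_def arc_def)
  have g1: "gauss_diagram (fill [[Over x ex], M, [Under y ey]] C)"
    by (subst gauss_diagram_fill[where cs = "[(x, ex), (y, ey)]"])
      (use C E fresh signs in \<open>auto simp: eval_nat_numeral M gauss_diagram_add_chord\<close>)
  have g2: "gauss_diagram (fill [P, M, Q] C)"
    by (subst gauss_diagram_fill[where cs = "[(x, ex), (y, ey), (z, ez), (t, et)]"])
      (use C E fresh t signs in \<open>auto simp: eval_nat_numeral M P_def Q_def et_def gauss_diagram_add_chord\<close>)
  have g3: "gauss_diagram (fill [[Under z ez], [], [Over z ez]] C)"
    by (subst gauss_diagram_fill[where cs = "[(z, ez)]"])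
      (use C E fresh signs in \<open>auto simp: eval_nat_numeral gauss_diagram_add_chord\<close>)
  define T where "T = [if p = 1 then [Arc 1, End (Over x ex)] else [End (Over x ex), Arc 1],
    map End M, if r = 1 then [End (Under y ey), Arc 0] else [Arc 0, End (Under y ey)]]"
  define over where "over = (if r = 1 then [Over t et, Over z ez] else [Over z ez, Over t et])"
  define under where "under = (if p = 1 then [Under z ez, Under t et] else [Under t et, Under z ez])"
  have "local_move [over, under] [[], []] (fill [P, M, Q] C) (fill [[Over x ex], M, [Under y ey]] C)"
    by (rule local_move_nest[where T = T and E' = "M @ [Over x ex, Under y ey]"])
      (use C in \<open>auto simp: T_def fill_def P_def Q_def over_def under_def eval_nat_numeral has_arcs_def comp_def\<close>)
  then have "reidemeister_move (fill [P, M, Q] C) (fill [[Over x ex], M, [Under y ey]] C)"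
    using reidemeister_move.R2_parallel[of t et z] reidemeister_move.R2_opposite[of t et z]
      reidemeister_move.R2_parallel[of z ez t] reidemeister_move.R2_opposite[of z ez t]
    by (auto simp: over_def under_def et_def split: if_splits)
  then have eq1: "fill [[Over x ex], M, [Under y ey]] C \<approx> fill [P, M, Q] C"
    using g1 g2 by (blast intro: equivclp_sym eqv_reidemeister)
  define T' where "T' = [if p = 1 then [End (Under z ez), Arc 0] else [Arc 0, End (Under z ez)],
    [Arc 1], if r = 1 then [Arc 2, End (Over z ez)] else [End (Over z ez), Arc 2]]"
  have lm: "local_move [arc p (Under t et) (Over x ex), arc q (Under x ex) (Over y ey),
      arc r (Under y ey) (Over t et)] [[], [], []]
      (fill [P, M, Q] C) (fill [[Under z ez], [], [Over z ez]] C)"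
    by (rule local_move_nest[where T = T' and E' = "[Under z ez, Over z ez]"])
      (use C in \<open>auto simp: T'_def fill_def P_def Q_def M_def arc_def eval_nat_numeral has_arcs_def\<close>)
  have "vdelta_move (fill [P, M, Q] C) (fill [[Under z ez], [], [Over z ez]] C)"
    by (rule vdelta_move.intros[OF _ _ _ _ lm, of "et * ex * ey"])
      (use signs in \<open>auto simp: p_def r_def et_def\<close>)
  then have "fill [P, M, Q] C \<approx> fill [[Under z ez], [], [Over z ez]] C"
    using g2 g3 by (rule eqv_vdelta)
  with eq1 show ?thesis unfolding M_def by (rule equivclp_trans)
qed

text \<open>
  Split \<open>z\<close> into \<open>x\<close> and \<open>y\<close> with the intermediate place next to the terminal endpoint of \<open>z\<close>. Both
  endpoints of \<open>x\<close> are then adjacent, and a move I leaves \<open>y\<close>, which runs in the opposite direction.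
\<close>

lemma reverse_chord_rename:
  assumes C: "has_arcs 2 E C" and E: "gauss_diagram [E]"
    and fresh: "y \<noteq> z" "{y, z} \<inter> chord ` set E = {}"
    and signs: "{ey, ez} \<subseteq> {1, -1}"
  shows "fill [[Under z ez], [Over z ez]] C \<approx> fill [[Over y ey], [Under y ey]] C"
proof -
  obtain x where x: "x \<notin> chord ` set E" "x \<notin> set [y, z]"
    using exists_fresh by blast
  define T where "T = [[Arc 0, Arc 1], [Arc 2]]"
  have C': "has_arcs (length T) E C" using C by (simp add: T_def eval_nat_numeral)
  have "has_arcs 3 ([] @ E) (nest T C)"
    by (rule has_arcs_nest[OF C']) (simp add: has_arcs_def T_def eval_nat_numeral)
  from merge_chords[OF this, of x y z 1 ey ez 1]
  have "fill [[Over x 1], arc 1 (Under x 1) (Over y ey), [Under y ey]] (nest T C) \<approx>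
      fill [[Under z ez], [], [Over z ez]] (nest T C)"
    using E fresh signs x by auto
  then have 1: "fill [[Over x 1, Under x 1, Over y ey], [Under y ey]] C \<approx>
      fill [[Under z ez], [Over z ez]] C"
    by (simp add: fill_nest[OF C']) (simp add: fill_def T_def arc_def)
  have "local_move [[Over x 1, Under x 1]] [[]]
      (fill [[Over x 1, Under x 1, Over y ey], [Under y ey]] C) (fill [[Over y ey], [Under y ey]] C)"
    by (rule local_move_nest[where T = "[[Arc 0, End (Over y ey)], [End (Under y ey)]]"
          and E' = "[Over y ey, Under y ey]"])
      (use C in \<open>auto simp: fill_def has_arcs_def eval_nat_numeral\<close>)
  then have "reidemeister_move (fill [[Over x 1, Under x 1, Over y ey], [Under y ey]] C)
      (fill [[Over y ey], [Under y ey]] C)"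
    by (rule reidemeister_move.R1_over_under)
  moreover have "gauss_diagram (fill [[Over x 1, Under x 1, Over y ey], [Under y ey]] C)"
    by (subst gauss_diagram_fill[where cs = "[(x, 1), (y, ey)]"])
      (use C E fresh signs x in \<open>auto simp: eval_nat_numeral gauss_diagram_add_chord\<close>)
  moreover have "gauss_diagram (fill [[Over y ey], [Under y ey]] C)"
    by (subst gauss_diagram_fill[where cs = "[(y, ey)]"])
      (use C E fresh signs in \<open>auto simp: eval_nat_numeral gauss_diagram_add_chord\<close>)
  ultimately have "fill [[Over x 1, Under x 1, Over y ey], [Under y ey]] C \<approx>
      fill [[Over y ey], [Under y ey]] C"
    by (rule eqv_reidemeister)
  with 1 show ?thesis by (blast intro: equivclp_trans equivclp_sym)
qed

text \<open>Reversing a chord amounts to negating the flag \<open>b\<close> at both of its endpoints.\<close>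

definition endpt :: "bool \<Rightarrow> nat \<Rightarrow> int \<Rightarrow> endpoint" where
  "endpt b c e = (if b then Over c e else Under c e)"

text \<open>
  Three reversals, each of which introduces a different name, reverse the chord and can return to
  the original name and sign.
\<close>

lemma reverse_chord:
  assumes C: "has_arcs 2 E C" and E: "gauss_diagram [E]"
    and z: "z \<notin> chord ` set E" "e \<in> {1, -1}"
  shows "fill [[endpt b z e], [endpt (\<not> b) z e]] C \<approx> fill [[endpt b' z e], [endpt (\<not> b') z e]] C"
proof -
  obtain y where y: "y \<notin> chord ` set E" "y \<notin> set [z]"
    using exists_fresh by blast
  obtain x where x: "x \<notin> chord ` set E" "x \<notin> set [y, z]"
    using exists_fresh by blast
  note rev = reverse_chord_rename[OF C E]
  note [trans] = equivclp_trans
  have "fill [[Under z e], [Over z e]] C \<approx> fill [[Over y 1], [Under y 1]] C"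
    by (rule rev) (use y z in auto)
  also have "\<dots> \<approx> fill [[Under x 1], [Over x 1]] C"
    by (rule equivclp_sym, rule rev) (use x y in auto)
  also have "\<dots> \<approx> fill [[Over z e], [Under z e]] C"
    by (rule rev) (use x z in auto)
  finally show ?thesis
    by (cases b; cases b') (auto simp: endpt_def equivclp_sym)
qed

section \<open>Exchanging adjacent endpoints\<close>

text \<open>
  After reversing chords, \<open>x\<close> ends and \<open>y\<close> starts at the common place. Both orders of these two
  endpoints are then equivalent to one and the same single chord.
\<close>

lemma swap_in_context:
  assumes C: "has_arcs 3 E C" and E: "gauss_diagram [chord_ends [(x, ex), (y, ey)] @ E]"
  shows "fill [[endpt (\<not> a) x ex], [endpt a x ex, endpt b y ey], [endpt (\<not> b) y ey]] C \<approx>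
    fill [[endpt (\<not> a) x ex], [endpt b y ey, endpt a x ex], [endpt (\<not> b) y ey]] C"
proof -
  have g: "gauss_diagram [E]" "x \<noteq> y" "x \<notin> chord ` set E" "y \<notin> chord ` set E"
    "{ex, ey} \<subseteq> {1, -1}"
    using E by (auto simp: gauss_diagram_add_chord)
  define D where "D h a b = fill [[endpt (\<not> a) x ex],
    if h then [endpt a x ex, endpt b y ey] else [endpt b y ey, endpt a x ex],
    [endpt (\<not> b) y ey]] C" for h a b
  have rev_x: "D h a b \<approx> D h a' b" for h a a' b
  proof -
    define T where "T = [[Arc 0],
      if h then [Arc 1, End (endpt b y ey)] else [End (endpt b y ey), Arc 1],
      [End (endpt (\<not> b) y ey)]]"
    have C': "has_arcs (length T) E C" using C by (simp add: T_def eval_nat_numeral)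
    have "has_arcs 2 ([endpt b y ey, endpt (\<not> b) y ey] @ E) (nest T C)"
      by (rule has_arcs_nest[OF C']) (simp add: has_arcs_def T_def eval_nat_numeral)
    moreover have "gauss_diagram [[endpt b y ey, endpt (\<not> b) y ey] @ E]"
    proof -
      have "gauss_diagram [chord_ends [(y, ey)] @ E]"
        using g by (auto simp: gauss_diagram_add_chord)
      then show ?thesis
        by (rule iffD1[OF gauss_diagram_cong, rotated]) (simp add: endpt_def)
    qed
    ultimately have "fill [[endpt (\<not> a) x ex], [endpt (\<not> \<not> a) x ex]] (nest T C) \<approx>
        fill [[endpt (\<not> a') x ex], [endpt (\<not> \<not> a') x ex]] (nest T C)"
      by (rule reverse_chord) (use g in \<open>auto simp: endpt_def\<close>)
    then show ?thesis by (simp add: fill_nest[OF C']) (simp add: fill_def T_def D_def split: if_splits)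
  qed
  have rev_y: "D h a b \<approx> D h a b'" for h a b b'
  proof -
    define T where "T = [[End (endpt (\<not> a) x ex)],
      if h then [End (endpt a x ex), Arc 0] else [Arc 0, End (endpt a x ex)], [Arc 1]]"
    have C': "has_arcs (length T) E C" using C by (simp add: T_def eval_nat_numeral)
    have "has_arcs 2 ([endpt a x ex, endpt (\<not> a) x ex] @ E) (nest T C)"
      by (rule has_arcs_nest[OF C']) (simp add: has_arcs_def T_def eval_nat_numeral)
    moreover have "gauss_diagram [[endpt a x ex, endpt (\<not> a) x ex] @ E]"
    proof -
      have "gauss_diagram [chord_ends [(x, ex)] @ E]"
        using g by (auto simp: gauss_diagram_add_chord)
      then show ?thesis
        by (rule iffD1[OF gauss_diagram_cong, rotated]) (simp add: endpt_def)
    qed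
    ultimately have "fill [[endpt b y ey], [endpt (\<not> b) y ey]] (nest T C) \<approx>
        fill [[endpt b' y ey], [endpt (\<not> b') y ey]] (nest T C)"
      by (rule reverse_chord) (use g in \<open>auto simp: endpt_def\<close>)
    then show ?thesis by (simp add: fill_nest[OF C']) (simp add: fill_def T_def D_def split: if_splits)
  qed
  obtain z where z: "z \<notin> chord ` set E" "z \<notin> set [x, y]"
    using exists_fresh by blast
  have merge: "D h False True \<approx> fill [[Under z 1], [], [Over z 1]] C" for h
    using merge_chords[OF C g(1), of x y z ex ey 1 "if h then 1 else -1"] g z
    by (auto simp: D_def endpt_def arc_def split: if_splits)
  note [trans] = equivclp_trans
  have "D True a b \<approx> D True False True"
    using rev_x rev_y by (blast intro: equivclp_trans)
  also have "\<dots> \<approx> D False False True"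
    using merge by (blast intro: equivclp_trans equivclp_sym)
  also have "\<dots> \<approx> D False a b"
    using rev_x rev_y by (blast intro: equivclp_trans)
  finally show ?thesis by (simp add: D_def)
qed

lemma endpt_cases: obtains b c e where "X = endpt b c e"
  by (cases X) (metis endpt_def)+

lemma endpt_eq_iff [simp]: "endpt b c e = endpt b' c' e' \<longleftrightarrow> b = b' \<and> c = c' \<and> e = e'"
  by (auto simp: endpt_def)

lemma chord_endpt [simp]: "chord (endpt b c e) = c"
  by (simp add: endpt_def)

lemma other_endpt_in_diagram:
  assumes "gauss_diagram [w]" and "endpt b c e \<in> set w"
  shows "endpt (\<not> b) c e \<in> set w"
  using assms unfolding gauss_diagram_word by (cases b) (simp_all add: endpt_def)

lemma gauss_diagram_remove_chord:
  assumes "gauss_diagram [w]" and "mset w = mset (endpt b c e # endpt (\<not> b) c e # w')"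
  shows "gauss_diagram [w']" and "c \<notin> chord ` set w'"
proof -
  have "mset w = mset (Over c e # Under c e # w')"
    using assms(2) by (simp add: endpt_def)
  then have "gauss_diagram [Over c e # Under c e # w']"
    using assms(1) gauss_diagram_cong[of "[w]" "[Over c e # Under c e # w']"] by simp
  then show "gauss_diagram [w']" and "c \<notin> chord ` set w'"
    by (simp_all add: gauss_diagram_add_chord)
qed

text \<open>
  In a concrete word the places of the pattern are the two neighbours and, wherever they occur, the
  other endpoints of their chords.
\<close>

lemma swap_adjacent:
  assumes D: "gauss_diagram [u @ endpt a x ex # endpt b y ey # v]" and xy: "x \<noteq> y"
  shows "[u @ endpt a x ex # endpt b y ey # v] \<approx> [u @ endpt b y ey # endpt a x ex # v]"
proof -
  let ?X' = "endpt (\<not> a) x ex" and ?Y' = "endpt (\<not> b) y ey"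
  have mem: "?X' \<in> set (u @ v)" "?Y' \<in> set (u @ v)"
    using other_endpt_in_diagram[OF D, of a x ex] other_endpt_in_diagram[OF D, of b y ey] xy by auto
  define E where "E = filter (\<lambda>s. s \<noteq> ?X' \<and> s \<noteq> ?Y') (u @ v)"
  define tok where "tok s = (if s = ?X' then Arc 0 else if s = ?Y' then Arc 2 else End s)" for s
  define C where "C = [map tok u @ Arc 1 # map tok v]"
  have dist: "distinct (u @ v)" using D unfolding gauss_diagram_word by auto
  then have "distinct (?X' # ?Y' # E)" "set (?X' # ?Y' # E) = set (u @ v)"
    using mem xy by (auto simp: E_def)
  then have uv: "mset (u @ v) = mset (?X' # ?Y' # E)"
    using dist by (metis set_eq_iff_mset_eq_distinct)
  have tokE: "image_mset tok (mset E) = image_mset End (mset E)"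
    by (rule image_mset_cong) (auto simp: E_def tok_def)
  have "mset (concat C) = add_mset (Arc 1) (image_mset tok (mset (u @ v)))"
    by (simp add: C_def)
  also have "\<dots> = {#Arc 1, tok ?X', tok ?Y'#} + image_mset End (mset E)"
    unfolding uv by (simp add: tokE)
  also have "\<dots> = mset (map End E @ map Arc [0..<3])"
    using xy by (simp add: tok_def eval_nat_numeral)
  finally have C: "has_arcs 3 E C" unfolding has_arcs_def .
  have "fill_token [[?X'], ss, [?Y']] (tok s) = [s]" for ss s
    by (simp add: tok_def)
  then have fill: "fill [[?X'], ss, [?Y']] C = [u @ ss @ v]" for ss
    by (simp add: fill_def C_def comp_def)
  have "mset (u @ endpt a x ex # endpt b y ey # v) = mset (chord_ends [(x, ex), (y, ey)] @ E)"
    using uv by (simp add: endpt_def)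
  then have "gauss_diagram [chord_ends [(x, ex), (y, ey)] @ E]"
    using D by (subst gauss_diagram_cong[of _ "[u @ endpt a x ex # endpt b y ey # v]"]) simp_all
  from swap_in_context[OF C this, of a b] show ?thesis by (simp add: fill)
qed

section \<open>Unknotting\<close>

text \<open>
  The first endpoint is moved along \<open>v\<close> by exchanges until it meets the second one; the chord is then
  isolated.
\<close>

lemma remove_chord:
  assumes "gauss_diagram [u @ endpt b c e # v @ endpt (\<not> b) c e # w]"
  shows "[u @ endpt b c e # v @ endpt (\<not> b) c e # w] \<approx> [u @ v @ w]"
  using assms
proof (induction v arbitrary: u)
  case Nil
  define C where "C = [map End u @ Arc 0 # map End w]"
  have "local_move [[endpt b c e, endpt (\<not> b) c e]] [[]]
      (fill [[endpt b c e, endpt (\<not> b) c e]] C) (fill [[]] C)"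
    by (rule local_move_fill[where E = "u @ w"]) (auto simp: has_arcs_def C_def)
  then have "local_move [[endpt b c e, endpt (\<not> b) c e]] [[]]
      [u @ endpt b c e # endpt (\<not> b) c e # w] [u @ w]"
    by (simp add: fill_def C_def comp_def concat_map_singleton)
  then have "reidemeister_move [u @ endpt b c e # endpt (\<not> b) c e # w] [u @ w]"
    using reidemeister_move.R1_over_under reidemeister_move.R1_under_over
    by (cases b) (simp_all add: endpt_def)
  moreover have "gauss_diagram [u @ w]"
    by (rule gauss_diagram_remove_chord[OF Nil.prems]) simp
  ultimately have "[u @ endpt b c e # endpt (\<not> b) c e # w] \<approx> [u @ w]"
    using Nil.prems by (intro eqv_reidemeister) simp_all
  then show ?case by (simp only: append_Nil)
next
  case (Cons V v)
  obtain b' c' e' where V: "V = endpt b' c' e'" by (rule endpt_cases)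
  have "c \<notin> chord ` set (u @ V # v @ w)"
    by (rule gauss_diagram_remove_chord[OF Cons.prems]) simp
  then have "c \<noteq> c'" by (auto simp: V)
  with Cons.prems have "[u @ endpt b c e # V # v @ endpt (\<not> b) c e # w] \<approx>
      [u @ V # endpt b c e # v @ endpt (\<not> b) c e # w]"
    unfolding V by (intro swap_adjacent) simp_all
  moreover have "gauss_diagram [(u @ [V]) @ endpt b c e # v @ endpt (\<not> b) c e # w]"
    using Cons.prems
    by (subst gauss_diagram_cong[of _ "[u @ endpt b c e # (V # v) @ endpt (\<not> b) c e # w]"]) simp_all
  then have "[(u @ [V]) @ endpt b c e # v @ endpt (\<not> b) c e # w] \<approx> [(u @ [V]) @ v @ w]"
    by (rule Cons.IH)
  ultimately show ?case
    by (simp only: append_assoc append_Cons append_Nil) (rule equivclp_trans)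
qed

lemma knot_diagram_eqv_trivial: "gauss_diagram [w] \<Longrightarrow> [w] \<approx> [[]]"
proof (induction "length w" arbitrary: w rule: less_induct)
  case less
  show ?case
  proof (cases w)
    case (Cons X w')
    obtain b c e where X: "X = endpt b c e" by (rule endpt_cases)
    have "endpt (\<not> b) c e \<in> set w'"
      using other_endpt_in_diagram[OF less.prems, of b c e] by (auto simp: Cons X)
    then obtain u v where w': "w' = u @ endpt (\<not> b) c e # v"
      by (auto dest: split_list)
    have "[w] \<approx> [u @ v]"
      using remove_chord[of "[]" b c e u v] less.prems by (simp add: Cons X w')
    moreover have "gauss_diagram [u @ v]"
      by (rule gauss_diagram_remove_chord[OF less.prems]) (simp add: Cons X w')
    then have "[u @ v] \<approx> [[]]"
      by (intro less.hyps) (simp_all add: Cons w')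
    ultimately show ?thesis by (rule equivclp_trans)
  qed simp
qed

theorem theorem1p3:
  fixes K :: "endpoint list list set"
  assumes "K \<in> virtual_knots"
  shows "vdelta_equivalent K trivial_knot"
proof -
  obtain D where D: "D \<in> K" "length D = 1" and K: "K \<in> virtual_links"
    using assms by (auto simp: virtual_knots_def)
  then have "gauss_diagram D"
    using in_quotient_imp_subset[OF equiv_reidemeister_rel] by (auto simp: virtual_links_def)
  moreover obtain w where "D = [w]" using D(2) by (auto simp: length_Suc_conv)
  ultimately have "D \<approx> [[]]" using knot_diagram_eqv_trivial by simp
  moreover have "[[]] \<in> trivial_knot"
    by (simp add: trivial_knot_def reidemeister_rel_def gauss_diagram_def)
  ultimately show ?thesis using D(1) by (auto simp: vdelta_equivalent_def)
qed

end
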